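(* For $q\in\mathbb{C}$ with $|q|<1$, $$\sum_{i,j\ge0}\frac{q^{2i^2-2ij+2j^2-j}}{(q;q)_{2i}(q;q)_{2j}}=\sum_{i,j\ge0}\frac{q^{2i^2-2ij+2j^2-i+j}}{(q;q)_{2i}(q;q)_{2j+1}}=\sum_{i,j\ge0}\frac{q^{2i^2-2ij+2j^2+i}}{(q;q)_{2i+1}(q;q)_{2j+1}}=\frac{1}{(q;q^2)_\infty^2(q^{2},q^{8};q^{10})_\infty},$$ $$\sum_{i,j\ge0}\frac{q^{2i^2-2ij+2j^2+2i-j}}{(q;q)_{2i+1}(q;q)_{2j}}=\sum_{i,j\ge0}\frac{q^{2i^2-2ij+2j^2+i+j}}{(q;q)_{2i+1}(q;q)_{2j+1}}=\frac{1}{(q;q^2)_\infty^2(q^{4},q^{6};q^{10})_\infty}.$$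
   Context: For $|q|<1$: $(a;q)_\infty=\prod_{k\ge0}(1-aq^k)$; for integers $n\ge0$, $(a;q)_n=\prod_{k=0}^{n-1}(1-aq^k)$; and $(a_1,\dots,a_m;q)_\infty=\prod_{k=1}^m(a_k;q)_\infty$. *)

theory Defs
  imports "HOL-Analysis.Analysis"
begin

definition qpoch :: "complex \<Rightarrow> complex \<Rightarrow> nat \<Rightarrow> complex" where
  "qpoch a q n = (\<Prod>k<n. 1 - a * q ^ k)"

(* Intended for norm q < 1, where the product converges for every a
   (its value is 0 if some factor vanishes). *)
definition qpoch_inf :: "complex \<Rightarrow> complex \<Rightarrow> complex" where
  "qpoch_inf a q = (\<Prod>k. 1 - a * q ^ k)"

definition qpochs_inf :: "complex list \<Rightarrow> complex \<Rightarrow> complex" where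
  "qpochs_inf as q = (\<Prod>a\<leftarrow>as. qpoch_inf a q)"

end

(* In each double sum one inner summation runs over a single parity class of Euler's series
   sum_n z^n q^(n(n-1)/2) / (q;q)_n = (-z;q)_inf at z = q^(-i).  Since (q^(-i);q)_inf = 0, both
   parity classes contribute (-q^(-i);q)_inf / 2, a multiple of (-q;q)_inf.  What remains are the
   three Rogers sums over n of
     q^(n(3n-1)/2) / ((q;q)_n (q;q^2)_n),
     q^(n(3n+1)/2) / ((q;q)_n (q;q^2)_(n+1)),
     q^(3n(n+1)/2) / ((q;q)_n (q;q^2)_(n+1)).
   Their summands come from the alternating sums of (-1)^k q^(k^2+ck) [2n+s, n-2k], which the
   q-Pascal rules evaluate in closed form.  Exchanging the two sums, with
   sum_n q^(n^2+nL) / ((q;q)_n (q;q)_(n+L)) = 1/(q;q)_inf, leaves theta series with exponents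
   5k^2+k and 5k^2+3k, which the Jacobi triple product factors. *)
theory Submission
  imports Defs
begin

section \<open>q-Pochhammer symbols and Euler's series\<close>

text \<open>For n = 2j the Euler exponent n(n-1)/2 - i n is 2j^2 - j - 2ij, and for n = 2j+1 it is
  2j^2 + j - 2ij - i. Each of the five exponents is one of these, possibly with i and j exchanged,
  plus a polynomial in the other index. The third exponent splits only with i as the inner index.
  The negative powers q^(-i) require q to be nonzero, so q = 0 is treated separately. The sums over
  n and k are exchanged after n -> n + 2k, which turns n^2 + k^2 into n^2 + 4kn + 5k^2. This is the
  source of the 5 in the theta exponents, and it makes L = 4k + s run through negative values as
  well. The Durfee sum is therefore needed at every integer L, and the auxiliary sums behind it run
  over the integers.\<close>

lemma qpoch_0 [simp]: "qpoch a q 0 = 1"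
  by (simp add: qpoch_def)

lemma qpoch_Suc [simp]: "qpoch a q (Suc n) = qpoch a q n * (1 - a * q ^ n)"
  by (simp add: qpoch_def)

lemma qpoch_add: "qpoch a q (m + n) = qpoch a q m * qpoch (a * q ^ m) q n"
  by (induction n) (simp_all add: power_add mult.assoc)

text \<open>The exponents below mn are grouped by their residue modulo m. The infinite form splits
  (q;q)_inf into even and odd exponents and (q^2;q^2)_inf into five products with base q^10.\<close>

lemma qpoch_dissect:
  "qpoch a q (m * n) = (\<Prod>r<m. qpoch (a * q ^ r) (q ^ m) n)"
proof (induction n)
  case (Suc n)
  have "qpoch a q (m * Suc n) = qpoch a q (m * n) * qpoch (a * q ^ (m * n)) q m"
    by (subst qpoch_add [symmetric]) (simp add: add.commute)
  also have "\<dots> = (\<Prod>r<m. qpoch (a * q ^ r) (q ^ m) n * (1 - a * q ^ r * (q ^ m) ^ n))"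
    by (simp add: Suc.IH prod.distrib) (simp add: qpoch_def power_mult mult_ac)
  finally show ?case by simp
qed simp

lemma power_ne_1_if_norm_less_1:
  fixes q :: complex
  assumes "norm q < 1" "n > 0"
  shows "q ^ n \<noteq> 1"
proof
  assume "q ^ n = 1"
  then have "norm q ^ n = 1" by (metis norm_one norm_power)
  moreover have "norm q ^ n < 1" using assms by (simp add: power_less_one_iff)
  ultimately show False by simp
qed

lemma qpoch_nonzero:
  assumes "norm q < 1"
  shows "qpoch q q n \<noteq> 0"
  using power_ne_1_if_norm_less_1 [OF assms, of "Suc _"] by (auto simp: qpoch_def)

lemma convergent_prod_qpoch:
  fixes q :: complex
  assumes "norm q < 1"
  shows "convergent_prod (\<lambda>k. 1 - a * q ^ k)"
proof (intro abs_convergent_prod_imp_convergent_prod summable_imp_abs_convergent_prod)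
  show "summable (\<lambda>k. norm (1 - a * q ^ k - 1))"
    using assms by (simp add: norm_mult norm_power summable_mult summable_geometric)
qed

lemma qpoch_LIMSEQ:
  assumes "norm q < 1"
  shows "qpoch a q \<longlonglongrightarrow> qpoch_inf a q"
proof -
  have "(\<lambda>n. \<Prod>k\<le>n. 1 - a * q ^ k) \<longlonglongrightarrow> qpoch_inf a q"
    unfolding qpoch_inf_def using convergent_prod_qpoch [OF assms] by (rule convergent_prod_LIMSEQ)
  then have "(\<lambda>n. qpoch a q (Suc n)) \<longlonglongrightarrow> qpoch_inf a q"
    by (simp only: qpoch_def lessThan_Suc_atMost)
  then show ?thesis by (rule LIMSEQ_imp_Suc)
qed

lemma qpoch_inf_nonzero:
  assumes "norm q < 1" "norm a < 1"
  shows "qpoch_inf a q \<noteq> 0"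
  unfolding qpoch_inf_def
proof (rule prodinf_nonzero [OF convergent_prod_qpoch [OF assms(1)]])
  fix k
  have "norm (a * q ^ k) \<le> norm a * 1"
    using assms by (simp add: norm_mult norm_power mult_left_le power_le_one)
  then show "1 - a * q ^ k \<noteq> 0" using assms by auto
qed

lemma qpoch_inf_split:
  assumes "norm q < 1"
  shows "qpoch_inf a q = qpoch a q m * qpoch_inf (a * q ^ m) q"
proof -
  have "(\<lambda>n. qpoch a q m * qpoch (a * q ^ m) q n) \<longlonglongrightarrow> qpoch a q m * qpoch_inf (a * q ^ m) q"
    by (intro tendsto_mult_left qpoch_LIMSEQ assms)
  moreover have "(\<lambda>n. qpoch a q m * qpoch (a * q ^ m) q n) \<longlonglongrightarrow> qpoch_inf a q"
    using LIMSEQ_ignore_initial_segment [OF qpoch_LIMSEQ [OF assms], of a m]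
    by (simp add: add.commute [of _ m] qpoch_add)
  ultimately show ?thesis by (rule LIMSEQ_unique [THEN sym])
qed

lemma qpoch_inf_dissect:
  assumes "norm q < 1" "m > 0"
  shows "qpoch_inf a q = (\<Prod>r<m. qpoch_inf (a * q ^ r) (q ^ m))"
proof -
  have "norm (q ^ m) < 1" using assms by (simp add: norm_power power_less_one_iff)
  then have "(\<lambda>n. qpoch a q (m * n)) \<longlonglongrightarrow> (\<Prod>r<m. qpoch_inf (a * q ^ r) (q ^ m))"
    unfolding qpoch_dissect by (intro tendsto_prod qpoch_LIMSEQ)
  moreover have "strict_mono (\<lambda>n. m * n)" using assms by (simp add: strict_mono_def)
  then have "(\<lambda>n. qpoch a q (m * n)) \<longlonglongrightarrow> qpoch_inf a q"
    using LIMSEQ_subseq_LIMSEQ [OF qpoch_LIMSEQ [OF assms(1)]] by (simp add: o_def)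
  ultimately show ?thesis by (rule LIMSEQ_unique [THEN sym])
qed

lemma qpoch_inf_mult_uminus:
  assumes "norm q < 1"
  shows "qpoch_inf a q * qpoch_inf (- a) q = qpoch_inf (a\<^sup>2) (q\<^sup>2)"
proof -
  have "1 - a\<^sup>2 * (q\<^sup>2) ^ k = (1 - a * q ^ k) * (1 - (- a) * q ^ k)" for k
    by (simp add: algebra_simps power2_eq_square power_mult_distrib)
  then show ?thesis
    unfolding qpoch_inf_def
    by (simp only: prodinf_mult [OF convergent_prod_qpoch [OF assms] convergent_prod_qpoch [OF assms]])
qed

text \<open>The reciprocals converge because (q;q)_inf is nonzero. With this bound every absolute
  convergence proof can drop the denominators and compare with powers of
  \<open>norm q\<close>.\<close>

lemma norm_inverse_qpoch_bounded:
  assumes "norm q < 1"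
  obtains C where "C > 0" "\<And>n. norm (1 / qpoch q q n) \<le> C"
proof -
  have "(\<lambda>n. 1 / qpoch q q n) \<longlonglongrightarrow> 1 / qpoch_inf q q"
    by (intro tendsto_divide qpoch_LIMSEQ qpoch_inf_nonzero assms tendsto_const)
  then have "Bseq (\<lambda>n. 1 / qpoch q q n)"
    by (intro convergent_imp_Bseq) (auto simp: convergent_def)
  then show ?thesis using that by (auto simp: Bseq_def)
qed

text \<open>The series solves F(z) = (1 + z) F(zq). Iteration pulls out the factors 1 + z q^k, and
  continuity at 0 together with F(0) = 1 disposes of the remainder.\<close>

lemma euler_has_sum:
  assumes "norm q < 1"
  shows "((\<lambda>n. q ^ (n * (n - 1) div 2) * z ^ n / qpoch q q n) has_sum qpoch_inf (- z) q) UNIV"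
proof -
  define c where "c n = q ^ (n * (n - 1) div 2) / qpoch q q n" for n
  define F where "F z = (\<Sum>n. c n * z ^ n)" for z
  \<comment> \<open>Coefficient form of F(z) - F(zq) = z F(zq).\<close>
  have c_Suc: "c (Suc n) * (1 - q ^ Suc n) = c n * q ^ n" for n
  proof -
    have "Suc n * n div 2 = n * (n - 1) div 2 + n"
      by (cases n) (simp_all add: algebra_simps)
    moreover have "1 - q * q ^ n \<noteq> 0"
      using power_ne_1_if_norm_less_1 [OF assms, of "Suc n"] by simp
    ultimately show ?thesis by (simp add: c_def power_add)
  qed
  have norm_summ: "summable (\<lambda>n. norm (c n * z ^ n))" for z
  proof -
    \<comment> \<open>Consecutive terms have a ratio tending to 0, so 1/2 is just a convenient bound
      below 1.\<close>
    have "(\<lambda>n. norm (q ^ n * z / (1 - q ^ Suc n))) \<longlonglongrightarrow> norm (0 * z / (1 - 0))"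
      using assms
      by (intro tendsto_intros LIMSEQ_Suc [of "\<lambda>n. q ^ n"] LIMSEQ_power_zero) auto
    then have "\<forall>\<^sub>F n in sequentially. norm (q ^ n * z / (1 - q ^ Suc n)) < 1/2"
      by (rule order_tendstoD) simp
    then obtain N where N: "\<And>n. n \<ge> N \<Longrightarrow> norm (q ^ n * z / (1 - q ^ Suc n)) < 1/2"
      by (auto simp: eventually_sequentially)
    show ?thesis
    proof (rule summable_ratio_test [of "1/2" N])
      fix n assume "n \<ge> N"
      have "1 - q ^ Suc n \<noteq> 0"
        using power_ne_1_if_norm_less_1 [OF assms, of "Suc n"] by simp
      then have "c (Suc n) = c n * q ^ n / (1 - q ^ Suc n)"
        using c_Suc [of n] by (simp add: eq_divide_eq)
      then have "c (Suc n) * z ^ Suc n = (q ^ n * z / (1 - q ^ Suc n)) * (c n * z ^ n)"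
        by (simp add: mult_ac)
      then have "norm (c (Suc n) * z ^ Suc n)
          = norm (q ^ n * z / (1 - q ^ Suc n)) * norm (c n * z ^ n)"
        by (simp only: norm_mult)
      also have "\<dots> \<le> 1/2 * norm (c n * z ^ n)"
        using N [OF \<open>n \<ge> N\<close>] by (intro mult_right_mono) auto
      finally show "norm (norm (c (Suc n) * z ^ Suc n)) \<le> 1/2 * norm (norm (c n * z ^ n))"
        by simp
    qed simp
  qed
  have summ: "summable (\<lambda>n. c n * z ^ n)" for z
    using norm_summ by (rule summable_norm_cancel)
  have F_rec: "F z = (1 + z) * F (z * q)" for z
  proof -
    have "F z - F (z * q) = (\<Sum>n. c n * z ^ n - c n * (z * q) ^ n)"
      unfolding F_def by (rule suminf_diff [OF summ summ])
    also have "\<dots> = (\<Sum>n. c (Suc n) * z ^ Suc n - c (Suc n) * (z * q) ^ Suc n)"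
      by (subst suminf_split_head [OF summable_diff [OF summ summ]]) simp
    also have "\<dots> = (\<Sum>n. z * (c n * (z * q) ^ n))"
    proof (rule suminf_cong)
      fix n
      have "c (Suc n) * z ^ Suc n - c (Suc n) * (z * q) ^ Suc n
          = (c (Suc n) * (1 - q ^ Suc n)) * z ^ Suc n"
        by (simp add: power_mult_distrib algebra_simps)
      also have "\<dots> = z * (c n * (z * q) ^ n)"
        unfolding c_Suc by (simp add: power_mult_distrib)
      finally show "c (Suc n) * z ^ Suc n - c (Suc n) * (z * q) ^ Suc n
          = z * (c n * (z * q) ^ n)" .
    qed
    also have "\<dots> = z * F (z * q)"
      unfolding F_def by (rule suminf_mult [OF summ])
    finally show ?thesis by (simp add: algebra_simps)
  qed
  have F_iter: "F z = qpoch (- z) q n * F (z * q ^ n)" for z n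
  proof (induction n)
    case (Suc n)
    then show ?case using F_rec [of "z * q ^ n"] by (simp add: mult_ac)
  qed simp
  have "(\<lambda>n. qpoch (- z) q n * F (z * q ^ n)) \<longlonglongrightarrow> qpoch_inf (- z) q * F (z * 0)"
    using assms
    by (intro tendsto_mult qpoch_LIMSEQ isCont_tendsto_compose [of _ F] tendsto_const
        LIMSEQ_power_zero) (auto simp: F_def [abs_def] intro: isCont_powser_converges_everywhere summ)
  moreover have "F 0 = 1"
    using powser_zero [of c] by (simp add: F_def c_def)
  ultimately have "F z = qpoch_inf (- z) q"
    by (simp add: F_iter [symmetric] LIMSEQ_const_iff)
  then have "(\<lambda>n. c n * z ^ n) sums qpoch_inf (- z) q"
    using summable_sums [OF summ, of z] by (simp add: F_def)
  from norm_summable_imp_has_sum [OF norm_summ this] show ?thesis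
    by (simp add: c_def)
qed

section \<open>Summation over the integers and the Durfee rectangle sum\<close>

lemma has_sum_diff:
  fixes f g :: "'a \<Rightarrow> 'b :: real_normed_vector"
  assumes "(f has_sum a) A" "(g has_sum b) A"
  shows "((\<lambda>x. f x - g x) has_sum (a - b)) A"
  using has_sum_add [OF assms(1), of "\<lambda>x. - g x" "- b"] assms(2) by (simp add: has_sum_uminus)

lemma has_sum_shift_int:
  fixes f :: "int \<Rightarrow> 'a :: topological_comm_monoid_add"
  shows "((\<lambda>k. f (k + c)) has_sum S) UNIV \<longleftrightarrow> (f has_sum S) UNIV"
  by (rule has_sum_reindex_bij_witness [of _ "\<lambda>k. k - c" "\<lambda>k. k + c"]) auto

lemma summable_on_power_abs_int:
  fixes x :: real
  assumes "0 \<le> x" "x < 1"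
  shows "(\<lambda>k::int. x ^ nat \<bar>k\<bar>) summable_on UNIV"
proof -
  have "(\<lambda>n. x ^ n) summable_on UNIV"
    using assms by (intro norm_summable_imp_summable_on) (simp add: norm_power summable_geometric)
  then have "(\<lambda>k::int. x ^ nat \<bar>k\<bar>) summable_on range int"
    and "(\<lambda>k::int. x ^ nat \<bar>k\<bar>) summable_on range (\<lambda>n. - int n)"
    by (subst summable_on_reindex; simp add: inj_def o_def)+
  then have "(\<lambda>k::int. x ^ nat \<bar>k\<bar>) summable_on (range int \<union> range (\<lambda>n. - int n))"
    by (rule summable_on_union)
  moreover have "range int \<union> range (\<lambda>n. - int n) = UNIV"
  proof -
    have "k \<in> range int \<union> range (\<lambda>n. - int n)" for k
      by (cases k rule: int_cases2) auto
    then show ?thesis by blast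
  qed
  ultimately show ?thesis by simp
qed

lemma summable_on_powi_quadratic:
  fixes x :: real and c :: int
  assumes "0 < x" "x < 1"
  shows "(\<lambda>k::int. x powi (k\<^sup>2 + c * k)) summable_on UNIV"
proof (rule summable_on_comparison_test)
  show "(\<lambda>k::int. x powi (- ((\<bar>c\<bar> + 1)\<^sup>2)) * x ^ nat \<bar>k\<bar>) summable_on UNIV"
    using assms by (intro summable_on_cmult_right summable_on_power_abs_int) auto
next
  fix k :: int
  \<comment> \<open>Completing the square in k^2 - a |k| + a^2 with a = |c| + 1 bounds the exponent
    below by |k| - a^2, so a geometric series dominates.\<close>
  have "0 \<le> (2 * \<bar>k\<bar> - (\<bar>c\<bar> + 1))\<^sup>2 + 3 * (\<bar>c\<bar> + 1)\<^sup>2"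
    by simp
  also have "\<dots> = 4 * (\<bar>k\<bar>\<^sup>2 - \<bar>c\<bar> * \<bar>k\<bar> - \<bar>k\<bar> + (\<bar>c\<bar> + 1)\<^sup>2)"
    by (simp only: power2_eq_square algebra_simps)
  also have "\<bar>k\<bar>\<^sup>2 - \<bar>c\<bar> * \<bar>k\<bar> \<le> k\<^sup>2 + c * k"
    by (simp add: abs_mult [symmetric])
  finally have "- ((\<bar>c\<bar> + 1)\<^sup>2) + \<bar>k\<bar> \<le> k\<^sup>2 + c * k"
    by simp
  then have "x powi (k\<^sup>2 + c * k) \<le> x powi (- ((\<bar>c\<bar> + 1)\<^sup>2) + \<bar>k\<bar>)"
    using assms by (intro power_int_decreasing) auto
  also have "\<dots> = x powi (- ((\<bar>c\<bar> + 1)\<^sup>2)) * x ^ nat \<bar>k\<bar>"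
    using assms by (subst power_int_add) (simp_all add: power_int_nonneg_exp)
  finally show "x powi (k\<^sup>2 + c * k) \<le> x powi (- ((\<bar>c\<bar> + 1)\<^sup>2)) * x ^ nat \<bar>k\<bar>" .
qed (use assms in auto)

lemma summable_on_product_mult:
  fixes f :: "'a \<Rightarrow> real" and g :: "'b \<Rightarrow> real"
  assumes "f summable_on A" "g summable_on B" "\<And>x. f x \<ge> 0" "\<And>y. g y \<ge> 0"
  shows "(\<lambda>(x, y). f x * g y) summable_on (A \<times> B)"
proof (rule summable_on_SigmaI)
  fix x
  show "((\<lambda>y. case (x, y) of (x, y) \<Rightarrow> f x * g y) has_sum f x * infsum g B) B"
    using assms by (simp add: has_sum_cmult_right)
qed (use assms in \<open>auto intro: summable_on_cmult_left\<close>)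

section \<open>Durfee rectangle sums at every integer parameter\<close>

locale q_base =
  fixes q :: complex
  assumes q_nonzero: "q \<noteq> 0" and q_norm: "norm q < 1"
begin

lemma norm_q_pos: "0 < norm q"
  using q_nonzero by simp

lemma powi_add: "q powi (a + b) = q powi a * q powi b"
  using q_nonzero by (simp add: power_int_add)

text \<open>Extended by zero, the reciprocals satisfy their recurrence at every integer, so sums over the
  integers have no boundary terms.\<close>

definition rq :: "int \<Rightarrow> complex" where
  "rq m = (if m < 0 then 0 else 1 / qpoch q q (nat m))"

lemma rq_neg [simp]: "m < 0 \<Longrightarrow> rq m = 0"
  by (simp add: rq_def)

lemma rq_of_nat [simp]: "rq (int n) = 1 / qpoch q q n"
  by (simp add: rq_def)

lemma rq_0 [simp]: "rq 0 = 1"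
  by (simp add: rq_def)

text \<open>The delicate index is m = 0: there the extension by zero is consistent because 1 - q^0 =
  0.\<close>

lemma rq_minus_one: "rq (m - 1) = (1 - q powi m) * rq m"
proof (cases m rule: int_cases2)
  case (nonneg n)
  show ?thesis
  proof (cases n)
    case (Suc k)
    have "1 - q * q ^ k \<noteq> 0"
      using power_ne_1_if_norm_less_1 [OF q_norm, of "Suc k"] by simp
    moreover have "q powi (1 + int k) = q * q ^ k"
      using q_nonzero by (simp add: power_int_add)
    ultimately show ?thesis
      using nonneg Suc qpoch_nonzero [OF q_norm, of k] rq_of_nat [of "Suc k"] by (simp add: field_simps)
  qed (use nonneg in auto)
next
  case (nonpos n)
  then show ?thesis by (cases n) auto
qed

lemma rq_bounded:
  obtains C where "C > 0" "\<And>m. norm (rq m) \<le> C"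
proof -
  obtain C where "C > 0" "\<And>n. norm (1 / qpoch q q n) \<le> C"
    using norm_inverse_qpoch_bounded [OF q_norm] by blast
  then have "norm (rq m) \<le> C" for m
    by (simp add: rq_def less_imp_le)
  with \<open>C > 0\<close> show ?thesis by (rule that)
qed

lemma rq_LIMSEQ: "(\<lambda>n. rq (int n)) \<longlonglongrightarrow> 1 / qpoch_inf q q"
  unfolding rq_of_nat
  by (intro tendsto_divide qpoch_LIMSEQ qpoch_inf_nonzero q_norm tendsto_const)

text \<open>The exponent is the area of an m by m + L rectangle. For L >= 0 the term generates the
  partitions whose Durfee rectangle has this size, so the sum over m should generate all partitions,
  independently of L.\<close>

definition durfee_term :: "int \<Rightarrow> int \<Rightarrow> complex" where
  "durfee_term L m = q powi (m\<^sup>2 + m * L) * rq m * rq (m + L)"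

definition durfee_sum :: "int \<Rightarrow> complex" where
  "durfee_sum L = (\<Sum>\<^sub>\<infinity>m. durfee_term L m)"

lemma durfee_has_sum_durfee_sum: "(durfee_term L has_sum durfee_sum L) UNIV"
proof -
  obtain C where C: "C > 0" "\<And>m. norm (rq m) \<le> C"
    using rq_bounded by blast
  have "(\<lambda>m. norm (durfee_term L m)) summable_on UNIV"
  proof (rule Infinite_Sum.abs_summable_on_comparison_test')
    show "(\<lambda>m. norm q powi (m\<^sup>2 + L * m) * (C * C)) summable_on UNIV"
      by (intro summable_on_cmult_left summable_on_powi_quadratic norm_q_pos q_norm)
    show "norm (durfee_term L m) \<le> norm q powi (m\<^sup>2 + L * m) * (C * C)" for m
      unfolding durfee_term_def norm_mult norm_power_int mult.assoc mult.commute [of m L]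
      using C by (intro mult_left_mono mult_mono) auto
  qed
  then have "durfee_term L summable_on UNIV" by (rule abs_summable_summable)
  then show ?thesis unfolding durfee_sum_def by (rule has_sum_infsum)
qed

text \<open>After shifting the index of the third series by one, all terms are multiples of one
  quantity X: the factors are 1 - q^(m+L+1) for L, q^m for L + 1, and 1 - q^m for q^(L+1) times the
  shifted term of L + 2.\<close>

lemma durfee_sum_diff:
  "durfee_sum L - durfee_sum (L + 1) = q powi (L + 1) * (durfee_sum (L + 2) - durfee_sum (L + 1))"
proof (rule has_sum_unique)
  show "((\<lambda>m. durfee_term L m - durfee_term (L + 1) m) has_sum
      durfee_sum L - durfee_sum (L + 1)) UNIV"
    by (intro has_sum_diff durfee_has_sum_durfee_sum)
  have "((\<lambda>m. q powi (L + 1) * (durfee_term (L + 2) (m + -1) - durfee_term (L + 1) m)) has_sum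
      q powi (L + 1) * (durfee_sum (L + 2) - durfee_sum (L + 1))) UNIV"
    by (intro has_sum_cmult_right has_sum_diff durfee_has_sum_durfee_sum
        has_sum_shift_int [THEN iffD2])
  moreover have "q powi (L + 1) * (durfee_term (L + 2) (m + -1) - durfee_term (L + 1) m)
      = durfee_term L m - durfee_term (L + 1) m" for m
  proof -
    define X where "X = q powi (m\<^sup>2 + m * L) * rq m * rq (m + L + 1)"
    have "durfee_term L m = (1 - q powi (m + L + 1)) * X"
      using rq_minus_one [of "m + L + 1"] by (simp add: durfee_term_def X_def)
    moreover have "durfee_term (L + 1) m = q powi m * X"
      by (simp add: durfee_term_def X_def distrib_left powi_add add.assoc [symmetric])
    moreover have "q powi (L + 1) * durfee_term (L + 2) (m + -1) = (1 - q powi m) * X"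
    proof -
      have "L + 1 + ((m + -1)\<^sup>2 + (m + -1) * (L + 2)) = m\<^sup>2 + m * L"
        by (simp add: power2_eq_square algebra_simps)
      then have "q powi (L + 1) * q powi ((m + -1)\<^sup>2 + (m + -1) * (L + 2)) = q powi (m\<^sup>2 + m * L)"
        by (simp only: powi_add [symmetric])
      moreover have "rq (m + - 1 + (L + 2)) = rq (m + L + 1)" "rq (m + - 1) = (1 - q powi m) * rq m"
        by (simp_all add: rq_minus_one add_ac)
      ultimately show ?thesis
        unfolding durfee_term_def X_def by (simp only: mult.assoc [symmetric]) (simp only: mult_ac)
    qed
    moreover have "q powi (L + 1) * (q powi m * X) = q powi (m + L + 1) * X"
      by (simp add: powi_add)
    ultimately show ?thesis by (simp only: right_diff_distrib) (simp add: algebra_simps)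
  qed
  ultimately show "((\<lambda>m. durfee_term L m - durfee_term (L + 1) m) has_sum
      q powi (L + 1) * (durfee_sum (L + 2) - durfee_sum (L + 1))) UNIV"
    by simp
qed

text \<open>As the parameter n grows, only the term m = 0 survives, and it equals
  \<open>rq (int n)\<close>. Terms with m < 0 vanish, and for m > 0 the part m n of the exponent is
  at least n.\<close>

lemma durfee_sum_close:
  obtains M where "\<And>n. norm (durfee_sum (int n) - rq (int n)) \<le> M * norm q ^ n"
proof -
  obtain C where C: "C > 0" "\<And>m. norm (rq m) \<le> C"
    using rq_bounded by blast
  define T where "T = (\<Sum>\<^sub>\<infinity>m::int. norm q powi (m\<^sup>2 + 0 * m))"
  have T: "((\<lambda>m::int. norm q powi (m\<^sup>2 + 0 * m)) has_sum T) UNIV"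
    unfolding T_def by (intro has_sum_infsum summable_on_powi_quadratic norm_q_pos q_norm)
  have "norm (durfee_sum (int n) - rq (int n)) \<le> T * (C * C * norm q ^ n)" for n
  proof (rule norm_infsum_le)
    have "((\<lambda>m. if m = 0 then rq (int n) else 0) has_sum rq (int n)) (UNIV :: int set)"
      by (rule has_sum_finite_neutralI [of "{0}"]) auto
    then show "((\<lambda>m. durfee_term (int n) m - (if m = 0 then rq (int n) else 0)) has_sum
        durfee_sum (int n) - rq (int n)) UNIV"
      by (intro has_sum_diff durfee_has_sum_durfee_sum)
    show "((\<lambda>m::int. norm q powi (m\<^sup>2 + 0 * m) * (C * C * norm q ^ n)) has_sum
        T * (C * C * norm q ^ n)) UNIV"
      by (intro has_sum_cmult_left T)
    fix m :: int
    consider "m < 0" | "m = 0" | "m > 0" by linarith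
    then show "norm (durfee_term (int n) m - (if m = 0 then rq (int n) else 0))
        \<le> norm q powi (m\<^sup>2 + 0 * m) * (C * C * norm q ^ n)"
    proof cases
      case 3
      have "int n \<le> m * int n"
        using 3 mult_right_mono [of 1 m "int n"] by simp
      then have "norm q powi (m\<^sup>2 + m * int n) \<le> norm q powi (m\<^sup>2 + 0 * m + int n)"
        using 3 q_norm norm_q_pos by (intro power_int_decreasing) auto
      also have "\<dots> = norm q powi (m\<^sup>2 + 0 * m) * norm q ^ n"
        using q_nonzero by (simp add: power_int_add)
      finally have "norm q powi (m\<^sup>2 + m * int n) * (norm (rq m) * norm (rq (m + int n)))
          \<le> norm q powi (m\<^sup>2 + 0 * m) * norm q ^ n * (C * C)"
        using C by (intro mult_mono) auto
      then show ?thesis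
        using 3 by (simp add: durfee_term_def norm_mult norm_power_int mult_ac)
    qed (use C in \<open>auto simp: durfee_term_def\<close>)
  qed
  then show ?thesis by (intro that [of "T * (C * C)"]) (simp add: mult.assoc)
qed

text \<open>The differences \<open>d L\<close> satisfy \<open>d L = - q\<^bsup>L+1\<^esup> d (L + 1)\<close> and tend to zero, hence vanish.\<close>

lemma durfee_sum_eq: "durfee_sum L = 1 / qpoch_inf q q"
proof -
  define d where "d L = durfee_sum L - durfee_sum (L + 1)" for L
  have d_rec: "d L = - (q powi (L + 1)) * d (L + 1)" for L
    using durfee_sum_diff [of L] by (simp add: d_def add.assoc algebra_simps)
  obtain M where M: "\<And>n. norm (durfee_sum (int n) - rq (int n)) \<le> M * norm q ^ n"
    using durfee_sum_close by blast
  have lim: "(\<lambda>n. durfee_sum (int n)) \<longlonglongrightarrow> 1 / qpoch_inf q q"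
  proof (rule Lim_transform [OF rq_LIMSEQ])
    have lim0: "(\<lambda>n. M * norm q ^ n) \<longlonglongrightarrow> 0"
      using q_norm by (intro tendsto_mult_right_zero LIMSEQ_power_zero) simp
    show "(\<lambda>n. durfee_sum (int n) - rq (int n)) \<longlonglongrightarrow> 0"
      by (intro Lim_null_comparison [OF _ lim0] always_eventually allI M)
  qed
  have d_lim: "(\<lambda>n. d (int n)) \<longlonglongrightarrow> 0"
  proof -
    have "d (int n) = durfee_sum (int n) - durfee_sum (int (Suc n))" for n
      by (simp add: d_def add.commute)
    then show ?thesis
      using tendsto_diff [OF lim LIMSEQ_Suc [OF lim]] by simp
  qed
  \<comment> \<open>The factor q^(n+k+1) has norm at most 1, so the norms of d cannot decrease along
    the naturals. Since they tend to 0, they are all 0.\<close>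
  have d_mono: "norm (d (int n)) \<le> norm (d (int (n + k)))" for n k
  proof (induction k)
    case (Suc k)
    have "norm (d (int (n + k))) = norm q ^ (n + k + 1) * norm (d (int (n + Suc k)))"
    proof -
      have "int (n + k) + 1 = int (n + k + 1)" "int (n + Suc k) = int (n + k + 1)" by simp_all
      then show ?thesis
        using arg_cong [OF d_rec [of "int (n + k)"], of norm]
        by (simp only: norm_mult norm_minus_cancel power_int_of_nat norm_power)
    qed
    also have "\<dots> \<le> 1 * norm (d (int (n + Suc k)))"
      using q_norm by (intro mult_right_mono power_le_one) auto
    finally show ?case using Suc.IH by simp
  qed simp
  have d_nat: "d (int n) = 0" for n
  proof -
    have "(\<lambda>k. norm (d (int (n + k)))) \<longlonglongrightarrow> 0"
      using LIMSEQ_ignore_initial_segment [OF tendsto_norm_zero [OF d_lim], of n]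
      by (simp only: add.commute [of n])
    then have "norm (d (int n)) \<le> 0"
      by (rule LIMSEQ_le_const) (use d_mono in auto)
    then show ?thesis by simp
  qed
  \<comment> \<open>Below 0 the recurrence carries the zero value downward.\<close>
  have d_zero: "d L = 0" for L
  proof (induction L rule: int_induct [where k = 0])
    case (step1 i)
    then show ?case using d_nat [of "nat (i + 1)"] by simp
  next
    case (step2 i)
    then show ?case using d_rec [of "i - 1"] by simp
  qed (use d_nat [of 0] in simp)
  have const: "durfee_sum L = durfee_sum 0" for L
  proof (induction L rule: int_induct [where k = 0])
    case (step1 i)
    then show ?case using d_zero [of i] by (simp add: d_def)
  next
    case (step2 i)
    then show ?case using d_zero [of "i - 1"] by (simp add: d_def)
  qed simp
  have "(\<lambda>n. durfee_sum (int n)) = (\<lambda>n. durfee_sum 0)"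
    using const by (intro ext)
  with lim const [of L] show ?thesis by (simp add: LIMSEQ_const_iff)
qed

lemma durfee_has_sum: "(durfee_term L has_sum 1 / qpoch_inf q q) UNIV"
  using durfee_has_sum_durfee_sum [of L] by (simp add: durfee_sum_eq)

end

section \<open>Jacobi triple product and Bailey pairs\<close>

text \<open>Summable complex families are absolutely summable, so the product family is summable
  without a further hypothesis.\<close>

lemma has_sum_mult_complex:
  fixes f :: "'a \<Rightarrow> complex" and g :: "'b \<Rightarrow> complex"
  assumes f: "(f has_sum a) A" and g: "(g has_sum b) B"
  shows "((\<lambda>(x, y). f x * g y) has_sum a * b) (A \<times> B)"
proof (rule has_sum_SigmaI)
  show "((\<lambda>y. case (x, y) of (x, y) \<Rightarrow> f x * g y) has_sum f x * b) B" for x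
    using g by (simp add: has_sum_cmult_right)
  show "((\<lambda>x. f x * b) has_sum a * b) A"
    by (intro has_sum_cmult_left f)
  have "(\<lambda>(x, y). norm (f x) * norm (g y)) summable_on A \<times> B"
    using has_sum_imp_summable [OF f, THEN summable_on_iff_abs_summable_on_complex [THEN iffD1]]
      has_sum_imp_summable [OF g, THEN summable_on_iff_abs_summable_on_complex [THEN iffD1]]
    by (intro summable_on_product_mult) simp_all
  then have "(\<lambda>x. norm (case x of (x, y) \<Rightarrow> f x * g y)) summable_on A \<times> B"
    by (simp add: case_prod_unfold norm_mult)
  then show "(\<lambda>(x, y). f x * g y) summable_on A \<times> B"
    by (rule abs_summable_summable)
qed

lemma has_sum_int_iff_nat:
  fixes f :: "int \<Rightarrow> 'a :: {comm_monoid_add, topological_space}"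
  assumes "\<And>n. n < 0 \<Longrightarrow> f n = 0"
  shows "(f has_sum S) UNIV \<longleftrightarrow> ((\<lambda>n. f (int n)) has_sum S) UNIV"
proof -
  have "(f has_sum S) UNIV \<longleftrightarrow> (f has_sum S) (range int)"
  proof (rule has_sum_cong_neutral)
    fix n assume "n \<in> UNIV - range int"
    then have "n < 0" by (metis DiffD2 nonneg_int_cases not_le rangeI)
    then show "f n = 0" by (rule assms)
  qed auto
  also have "\<dots> \<longleftrightarrow> ((f \<circ> int) has_sum S) UNIV"
    by (rule has_sum_reindex) (simp add: inj_def)
  finally show ?thesis by (simp add: o_def)
qed

lemma minus_one_powi_minus: "(-1 :: complex) powi (- k) = (-1) powi k"
  by (simp add: power_int_minus flip: power_int_inverse)

text \<open>Rearrangement for the two Pascal rules: the second premise absorbs the power of q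
  produced by the rule into the quadratic exponent.\<close>

lemma mult_combine:
  fixes x :: complex
  assumes "(1 - x) * u = v + b * w" "e * b = n * e'"
  shows "(1 - x) * (s * e * u) = s * e * v + n * (s * e' * w)"
proof -
  have "(1 - x) * (s * e * u) = s * e * ((1 - x) * u)" by (simp only: mult_ac)
  also have "\<dots> = s * e * v + (e * b) * (s * w)"
    unfolding assms(1) by (simp only: distrib_left mult_ac)
  also have "\<dots> = s * e * v + n * (s * e' * w)"
    unfolding assms(2) by (simp only: mult_ac)
  finally show ?thesis .
qed

lemma mult_regroup:
  fixes a :: complex
  assumes "a * b = c * d"
  shows "a * (s * b * (x * y)) = s * c * (d * x * y)"
proof -
  have "a * (s * b * (x * y)) = (a * b) * (s * x * y)" by (simp only: mult_ac)
  then show ?thesis unfolding assms by (simp only: mult_ac)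
qed

lemma jacobi_regroup:
  fixes a :: complex
  assumes "a * (b * c) = d * e" "u * v = w * c"
  shows "w * d * (e * x * y) = (a * u * y) * (b * v * x)"
proof -
  have "w * d * (e * x * y) = (d * e) * (w * x * y)" by (simp only: mult_ac)
  also have "\<dots> = (w * c) * (a * b * x * y)"
    unfolding assms(1) [symmetric] by (simp only: mult_ac)
  also have "\<dots> = (a * u * y) * (b * v * x)"
    unfolding assms(2) [symmetric] by (simp only: mult_ac)
  finally show ?thesis .
qed

definition tri :: "int \<Rightarrow> int" where
  "tri k = k * (k - 1) div 2"

lemma two_times_tri: "2 * tri k = k * (k - 1)"
  by (simp add: tri_def)

lemma tri_of_nat: "tri (int n) = int (n * (n - 1) div 2)"
  by (cases n) (simp_all add: tri_def zdiv_int algebra_simps)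

context q_base
begin

section \<open>The Jacobi triple product and the theta series\<close>

lemma euler_has_sum_int:
  "((\<lambda>a. q powi tri a * z powi a * rq a) has_sum qpoch_inf (- z) q) UNIV"
  using euler_has_sum [OF q_norm, of z]
  by (subst has_sum_int_iff_nat) (simp_all only: rq_neg mult_zero_right tri_of_nat power_int_of_nat
      rq_of_nat times_divide_eq_right mult_1_right)

text \<open>Euler's series at z and at q/z are multiplied and the terms grouped by L = a - b. The
  sum over b is then a Durfee sum, whose value is the same for all L and comes out as a
  constant.\<close>

lemma jacobi_triple_product:
  assumes "z \<noteq> 0"
  shows "((\<lambda>k. z powi k * q powi tri k) has_sum
      qpoch_inf q q * qpoch_inf (- z) q * qpoch_inf (- (q / z)) q) UNIV"
proof -
  define f where "f = (\<lambda>(a, b). (q powi tri a * z powi a * rq a) * (q powi tri b * (q / z) powi b * rq b))"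
  have "(f has_sum qpoch_inf (- z) q * qpoch_inf (- (q / z)) q) (UNIV \<times> UNIV)"
    unfolding f_def by (intro has_sum_mult_complex euler_has_sum_int)
  also have "?this \<longleftrightarrow> ((\<lambda>(L, b). z powi L * q powi tri L * durfee_term L b) has_sum
      qpoch_inf (- z) q * qpoch_inf (- (q / z)) q) (UNIV \<times> UNIV)"
  proof (rule has_sum_reindex_bij_witness [of _ "\<lambda>(L, b). (b + L, b)" "\<lambda>(a, b). (a - b, b)"])
    fix x :: "int \<times> int"
    obtain L b where x: "x = (b + L, b)"
      by (metis add.commute diff_add_cancel prod.exhaust)
    \<comment> \<open>Doubling removes the division hidden in \<open>tri\<close>.\<close>
    have "2 * (tri (b + L) + (tri b + b)) = 2 * (tri L + (b\<^sup>2 + b * L))"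
      unfolding distrib_left two_times_tri by (simp add: power2_eq_square algebra_simps)
    then have "tri (b + L) + (tri b + b) = tri L + (b\<^sup>2 + b * L)" by simp
    then have "q powi tri (b + L) * (q powi tri b * q powi b) = q powi tri L * q powi (b\<^sup>2 + b * L)"
      by (simp only: powi_add [symmetric])
    moreover have "z powi (b + L) * (q / z) powi b = z powi L * q powi b"
      using assms by (simp add: power_int_add power_int_divide_distrib)
    ultimately have "z powi L * q powi tri L * (q powi (b\<^sup>2 + b * L) * rq b * rq (b + L))
        = (q powi tri (b + L) * z powi (b + L) * rq (b + L)) * (q powi tri b * (q / z) powi b * rq b)"
      by (rule jacobi_regroup)
    then show "(case case x of (a, b) \<Rightarrow> (a - b, b) of (L, b) \<Rightarrow> z powi L * q powi tri L * durfee_term L b) = f x"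
      by (simp add: x f_def durfee_term_def)
  qed auto
  finally have "((\<lambda>L. z powi L * q powi tri L * (1 / qpoch_inf q q)) has_sum
      qpoch_inf (- z) q * qpoch_inf (- (q / z)) q) UNIV"
    by (rule has_sum_SigmaD) (simp only: prod.case has_sum_cmult_right durfee_has_sum)
  from has_sum_cmult_right [OF this, of "qpoch_inf q q"] show ?thesis
    using qpoch_inf_nonzero [OF q_norm q_norm] by (simp add: mult.assoc)
qed

text \<open>The triple product with base q^10 at z = -q^(5+b), since 10 k(k-1)/2 + (5+b) k = 5k^2 +
  b k. The values needed are b = 1 and b = 3.\<close>

lemma theta_has_sum:
  assumes "b < 5"
  shows "((\<lambda>k. (-1) powi k * q powi (5 * k\<^sup>2 + int b * k)) has_sum
      qpoch_inf (q ^ 10) (q ^ 10) * qpoch_inf (q ^ (5 + b)) (q ^ 10) * qpoch_inf (q ^ (5 - b)) (q ^ 10)) UNIV"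
proof -
  interpret p: q_base "q ^ 10"
    using q_nonzero q_norm by unfold_locales (simp_all add: norm_power power_less_one_iff)
  have "(- (q ^ (5 + b))) powi k * (q ^ 10) powi tri k = (-1) powi k * q powi (5 * k\<^sup>2 + int b * k)" for k
  proof -
    have "int (5 + b) * k + int 10 * tri k = 5 * k\<^sup>2 + int b * k"
      using two_times_tri [of k] by (simp add: power2_eq_square algebra_simps)
    then have "(q ^ (5 + b)) powi k * (q ^ 10) powi tri k = q powi (5 * k\<^sup>2 + int b * k)"
      by (simp only: power_int_power powi_add [symmetric])
    then show ?thesis
      using power_int_mult_distrib [of "-1" "q ^ (5 + b)" k] by (simp add: mult.assoc)
  qed
  moreover have "- (q ^ 10 / - (q ^ (5 + b))) = q ^ (5 - b)"
  proof -
    have "q ^ 10 = q ^ (5 - b) * q ^ (5 + b)"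
      using assms by (simp add: power_add [symmetric])
    then show ?thesis using q_nonzero by simp
  qed
  ultimately show ?thesis
    using p.jacobi_triple_product [of "- (q ^ (5 + b))"] q_nonzero by simp
qed

section \<open>Alternating sums of q-binomial coefficients\<close>

text \<open>Up to the factor \<open>(q; q)\<^bsub>2n+s\<^esub>\<close> this is \<open>(-1)\<^sup>k q\<^bsup>k\<^sup>2+ck\<^esup>\<close> times the q-binomial coefficient
  \<open>[2n+s, n-2k]\<close>.\<close>

definition bterm :: "int \<Rightarrow> int \<Rightarrow> int \<Rightarrow> int \<Rightarrow> complex" where
  "bterm s c n k = (-1) powi k * q powi (k\<^sup>2 + c * k) * (rq (n - 2 * k) * rq (n + s + 2 * k))"

lemma bterm_summable: "bterm s c n summable_on UNIV"
proof (rule finite_nonzero_values_imp_summable_on)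
  have "bterm s c n k = 0" if "k \<notin> {- \<bar>n\<bar> - \<bar>s\<bar>..\<bar>n\<bar>}" for k
  proof -
    have "k > \<bar>n\<bar> \<or> k < - \<bar>n\<bar> - \<bar>s\<bar>" using that by auto
    then have "n - 2 * k < 0 \<or> n + s + 2 * k < 0" by linarith
    then show ?thesis by (auto simp: bterm_def)
  qed
  then have "{k \<in> UNIV. bterm s c n k \<noteq> 0} \<subseteq> {- \<bar>n\<bar> - \<bar>s\<bar>..\<bar>n\<bar>}" by blast
  then show "finite {k \<in> UNIV. bterm s c n k \<noteq> 0}"
    by (rule finite_subset) simp
qed

text \<open>The symmetry of the q-binomial coefficient. It yields the sum for s = -1 from the one
  for s = 1, and flips the sign of c when s = 0.\<close>

lemma bterm_reflect: "bterm s c n (- k) = bterm (- s) (- c) (n + s) k"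
  by (simp add: bterm_def minus_one_powi_minus mult_ac)

lemma bterm_has_sum_reflect:
  "(bterm s c n has_sum S) UNIV \<longleftrightarrow> (bterm (- s) (- c) (n + s) has_sum S) UNIV"
  by (rule has_sum_reindex_bij_witness [of _ uminus uminus])
    (auto simp: bterm_reflect [symmetric])

text \<open>The involution k -> -1 - k fixes k^2 + k, exchanges the two reciprocals and reverses the
  sign.\<close>

lemma bterm_two_has_sum_zero: "(bterm 2 1 n has_sum 0) UNIV"
proof -
  obtain S where S: "(bterm 2 1 n has_sum S) UNIV"
    using bterm_summable [of 2 1 n] unfolding summable_on_def by blast
  have "bterm 2 1 n (- 1 - k) = - bterm 2 1 n k" for k
  proof -
    have "(- 1 - k)\<^sup>2 + 1 * (- 1 - k) = k\<^sup>2 + 1 * k"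
      by (simp add: power2_eq_square algebra_simps)
    moreover have "(- 1 :: complex) powi (- 1 - k) = - ((- 1) powi k)"
      using minus_one_powi_minus [of "k + 1"] power_int_add_1 [of "-1 :: complex" k]
      by (simp add: algebra_simps)
    moreover have "n - 2 * (- 1 - k) = n + 2 + 2 * k" "n + 2 + 2 * (- 1 - k) = n - 2 * k"
      by simp_all
    ultimately show ?thesis
      by (simp only: bterm_def) (simp add: mult_ac)
  qed
  then have "((\<lambda>k. - bterm 2 1 n k) has_sum S) UNIV"
    using S by (subst has_sum_reindex_bij_witness [of _ "\<lambda>k. - 1 - k" "\<lambda>k. - 1 - k" _ "bterm 2 1 n"]) auto
  then have "(bterm 2 1 n has_sum - S) UNIV" by (simp add: has_sum_uminus)
  with S have "S = - S" by (rule has_sum_unique)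
  with S show ?thesis by simp
qed

text \<open>The two q-Pascal rules with denominators cleared; the first is 1 - q^(a+b) = (1 - q^b) +
  q^b (1 - q^a), the second has a and b exchanged.\<close>

lemma rq_pascal:
  "(1 - q powi (a + b)) * (rq a * rq b) = rq a * rq (b - 1) + q powi b * (rq (a - 1) * rq b)"
  "(1 - q powi (a + b)) * (rq a * rq b) = rq (a - 1) * rq b + q powi a * (rq a * rq (b - 1))"
  by (simp_all add: rq_minus_one powi_add algebra_simps)

text \<open>The upper index 2n + s + 1 drops by one in both terms. The factor q^b contains q^(2k),
  which raises the linear coefficient c by 2; in the companion rule q^a contains q^(-2k) and lowers
  it.\<close>

lemma bterm_pascal:
  "(1 - q powi (2 * n + s + 1)) * bterm (s + 1) c n k
    = bterm s c n k + q powi (n + s + 1) * bterm (s + 2) (c + 2) (n - 1) k"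
proof -
  define a b where "a = n - 2 * k" and "b = n + s + 1 + 2 * k"
  have "q powi (k\<^sup>2 + c * k) * q powi b = q powi (n + s + 1) * q powi (k\<^sup>2 + (c + 2) * k)"
    by (simp add: b_def powi_add [symmetric] algebra_simps)
  from mult_combine [OF rq_pascal(1) [of a b] this, of "(-1) powi k"]
  have "(1 - q powi (a + b)) * ((-1) powi k * q powi (k\<^sup>2 + c * k) * (rq a * rq b))
      = (-1) powi k * q powi (k\<^sup>2 + c * k) * (rq a * rq (b - 1))
        + q powi (n + s + 1) * ((-1) powi k * q powi (k\<^sup>2 + (c + 2) * k) * (rq (a - 1) * rq b))" .
  moreover have "a + b = 2 * n + s + 1" "a - 1 = n - 1 - 2 * k" "b - 1 = n + s + 2 * k"
    "n + (s + 1) + 2 * k = b" "n - 1 + (s + 2) + 2 * k = b"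
    by (simp_all add: a_def b_def)
  ultimately show ?thesis
    by (simp only: bterm_def a_def [symmetric])
qed

lemma bterm_pascal':
  "(1 - q powi (2 * n + s + 1)) * bterm (s + 1) c n k
    = bterm (s + 2) c (n - 1) k + q powi n * bterm s (c - 2) n k"
proof -
  define a b where "a = n - 2 * k" and "b = n + s + 1 + 2 * k"
  have "q powi (k\<^sup>2 + c * k) * q powi a = q powi n * q powi (k\<^sup>2 + (c - 2) * k)"
    by (simp add: a_def powi_add [symmetric] algebra_simps)
  from mult_combine [OF rq_pascal(2) [of a b] this, of "(-1) powi k"]
  have "(1 - q powi (a + b)) * ((-1) powi k * q powi (k\<^sup>2 + c * k) * (rq a * rq b))
      = (-1) powi k * q powi (k\<^sup>2 + c * k) * (rq (a - 1) * rq b)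
        + q powi n * ((-1) powi k * q powi (k\<^sup>2 + (c - 2) * k) * (rq a * rq (b - 1)))" .
  moreover have "a + b = 2 * n + s + 1" "a - 1 = n - 1 - 2 * k" "b - 1 = n + s + 2 * k"
    "n + (s + 1) + 2 * k = b" "n - 1 + (s + 2) + 2 * k = b"
    by (simp_all add: a_def b_def)
  ultimately show ?thesis
    by (simp only: bterm_def a_def [symmetric])
qed

lemma bterm_has_sum_step:
  assumes "(bterm s c n has_sum S) UNIV" "(bterm (s + 2) (c + 2) (n - 1) has_sum T) UNIV"
    and "q powi (2 * n + s + 1) \<noteq> 1"
  shows "(bterm (s + 1) c n has_sum (S + q powi (n + s + 1) * T) / (1 - q powi (2 * n + s + 1))) UNIV"
proof -
  have "((\<lambda>k. (1 - q powi (2 * n + s + 1)) * bterm (s + 1) c n k) has_sum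
      S + q powi (n + s + 1) * T) UNIV"
    unfolding bterm_pascal by (intro has_sum_add has_sum_cmult_right assms)
  then show ?thesis using assms(3) by (subst (asm) has_sum_cmult_right_iff) auto
qed

lemma bterm_has_sum_step':
  assumes "(bterm s (c - 2) n has_sum S) UNIV" "(bterm (s + 2) c (n - 1) has_sum T) UNIV"
    and "q powi (2 * n + s + 1) \<noteq> 1"
  shows "(bterm (s + 1) c n has_sum (T + q powi n * S) / (1 - q powi (2 * n + s + 1))) UNIV"
proof -
  have "((\<lambda>k. (1 - q powi (2 * n + s + 1)) * bterm (s + 1) c n k) has_sum
      T + q powi n * S) UNIV"
    unfolding bterm_pascal' by (intro has_sum_add has_sum_cmult_right assms)
  then show ?thesis using assms(3) by (subst (asm) has_sum_cmult_right_iff) auto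
qed

text \<open>Since (q;q)_(2n) = (q;q^2)_n (q;q)_n (-q;q)_n, this is q^(n(n-1)/2) / ((q;q)_n
  (q;q^2)_n), the beta side of a Bailey pair.\<close>

definition bpair :: "nat \<Rightarrow> complex" where
  "bpair n = q ^ (n * (n - 1) div 2) * qpoch (- q) q n / qpoch q q (2 * n)"

lemma powi_ne_1: "m > 0 \<Longrightarrow> q powi m \<noteq> 1"
  using power_ne_1_if_norm_less_1 [OF q_norm, of "nat m"] by (simp add: power_int_nonneg_exp)

text \<open>In either Pascal rule the partner of the s = 0 sum is the sum with s = 2 and c = 1,
  which vanishes.\<close>

lemma bterm_one_has_sum:
  assumes "(bterm 0 (-1) (int n) has_sum S) UNIV"
  shows "(bterm 1 (-1) (int n) has_sum S / (1 - q ^ (2 * n + 1))) UNIV"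
    and "(bterm 1 1 (int n) has_sum q ^ n * S / (1 - q ^ (2 * n + 1))) UNIV"
proof -
  have e: "q powi (2 * int n + 0 + 1) = q ^ (2 * n + 1)"
    using power_int_of_nat [of q "2 * n + 1"] by (simp add: add.commute)
  have ne: "q powi (2 * int n + 0 + 1) \<noteq> 1" by (rule powi_ne_1) simp
  show "(bterm 1 (-1) (int n) has_sum S / (1 - q ^ (2 * n + 1))) UNIV"
    using bterm_has_sum_step [of 0 "-1" "int n", OF assms _ ne, of 0] bterm_two_has_sum_zero
    unfolding e by simp
  show "(bterm 1 1 (int n) has_sum q ^ n * S / (1 - q ^ (2 * n + 1))) UNIV"
    using bterm_has_sum_step' [of 0 1 "int n" S 0] assms ne bterm_two_has_sum_zero
    unfolding e by simp
qed

text \<open>The induction step goes from s = 0 to s = 1 at n, reflects to s = -1 at n + 1, and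
  returns to s = 0 by a Pascal rule. Both inputs of that last rule equal V, and (1 + q^(n+1)) / (1 -
  q^(2n+2)) = 1 / (1 - q^(n+1)).\<close>

lemma bterm_zero_has_sum: "(bterm 0 (-1) (int n) has_sum bpair n) UNIV"
proof (induction n)
  case 0
  have "bterm 0 (-1) 0 k = 0" if "k \<noteq> 0" for k
    using that by (cases "k > 0") (auto simp: bterm_def)
  then show ?case
    by (intro has_sum_finite_neutralI [of "{0}"]) (auto simp: bterm_def bpair_def)
next
  case (Suc n)
  define V where "V = q ^ n * bpair n / (1 - q ^ (2 * n + 1))"
  have V: "(bterm 1 1 (int n) has_sum V) UNIV"
    unfolding V_def by (rule bterm_one_has_sum [OF Suc.IH])
  then have V': "(bterm (-1) (-1) (int n + 1) has_sum V) UNIV"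
    by (subst (asm) bterm_has_sum_reflect) simp
  have e: "q powi (2 * (int n + 1) + (- 1) + 1) = q ^ (2 * n + 2)" "q powi (int n + 1 + (- 1) + 1) = q ^ (n + 1)"
    using power_int_of_nat [of q "2 * n + 2"] power_int_of_nat [of q "n + 1"] by (simp_all add: add.commute)
  have "q powi (2 * (int n + 1) + (- 1) + 1) \<noteq> 1" by (rule powi_ne_1) simp
  then have "(bterm 0 (-1) (int n + 1) has_sum (V + q ^ (n + 1) * V) / (1 - q ^ (2 * n + 2))) UNIV"
    using bterm_has_sum_step [of "-1" "-1" "int n + 1" V V] V V' unfolding e by simp
  moreover have "(V + q ^ (n + 1) * V) / (1 - q ^ (2 * n + 2)) = bpair (Suc n)"
  proof -
    have "Suc n * n div 2 = n * (n - 1) div 2 + n"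
      by (cases n) (simp_all add: algebra_simps)
    then show ?thesis
      by (simp add: V_def bpair_def power_add divide_simps) (simp add: algebra_simps)
  qed
  ultimately show ?case by (simp add: add.commute)
qed

text \<open>One absolutely summable family over pairs of integers is summed in both orders: over k
  first it gives the values of beta, over n first a Durfee sum times a theta term.\<close>

lemma bailey_has_sum:
  assumes beta: "\<And>n. (bterm (int s) c (int n) has_sum \<beta> n) UNIV" and "s \<le> 1"
    and theta: "((\<lambda>k. (-1) powi k * q powi (5 * k\<^sup>2 + (c + 2 * int s) * k)) has_sum \<theta>) UNIV"
  shows "((\<lambda>n. q ^ (n\<^sup>2 + s * n) * \<beta> n) has_sum \<theta> / qpoch_inf q q) UNIV"
proof -
  define G where "G = (\<lambda>(n, k). q powi (n\<^sup>2 + int s * n) * bterm (int s) c n k)"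
  obtain C where C: "C > 0" "\<And>m. norm (rq m) \<le> C"
    using rq_bounded by blast
  have "(\<lambda>x. norm (G x)) summable_on UNIV \<times> UNIV"
  proof (rule Infinite_Sum.abs_summable_on_comparison_test')
    show "(\<lambda>x. (case x of (n, k) \<Rightarrow> norm q powi (n\<^sup>2 + int s * n) * norm q powi (k\<^sup>2 + c * k)) * (C * C))
        summable_on UNIV \<times> UNIV"
      using norm_q_pos q_norm
      by (intro summable_on_cmult_left summable_on_product_mult summable_on_powi_quadratic) auto
    fix x :: "int \<times> int"
    obtain n k where x: "x = (n, k)" by fastforce
    have "norm (G x) = norm q powi (n\<^sup>2 + int s * n) * norm q powi (k\<^sup>2 + c * k)
        * (norm (rq (n - 2 * k)) * norm (rq (n + int s + 2 * k)))"
      by (simp add: x G_def bterm_def norm_mult norm_power_int mult.assoc)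
    also have "\<dots> \<le> norm q powi (n\<^sup>2 + int s * n) * norm q powi (k\<^sup>2 + c * k) * (C * C)"
      using C by (intro mult_left_mono mult_mono) auto
    finally show "norm (G x) \<le> (case x of (n, k) \<Rightarrow>
        norm q powi (n\<^sup>2 + int s * n) * norm q powi (k\<^sup>2 + c * k)) * (C * C)"
      by (simp add: x)
  qed
  then have "G summable_on UNIV \<times> UNIV" by (rule abs_summable_summable)
  then obtain S where S: "(G has_sum S) (UNIV \<times> UNIV)" by (auto simp: summable_on_def)
  define \<beta>' where "\<beta>' n = (if n < 0 then 0 else q powi (n\<^sup>2 + int s * n) * \<beta> (nat n))" for n
  have "(\<beta>' has_sum S) UNIV"
  proof (rule has_sum_SigmaD [OF S])
    fix n :: int
    show "((\<lambda>k. G (n, k)) has_sum \<beta>' n) UNIV"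
    proof (cases "n < 0")
      case True
      have "G (n, k) = 0" for k
      proof -
        \<comment> \<open>The two arguments add up to 2n + s, which is negative for n < 0 and s <=
          1, so negative n contribute nothing.\<close>
        have "n - 2 * k < 0 \<or> n + int s + 2 * k < 0" using True \<open>s \<le> 1\<close> by linarith
        then show ?thesis by (auto simp: G_def bterm_def)
      qed
      with True show ?thesis by (simp add: \<beta>'_def)
    next
      case False
      then show ?thesis
        using has_sum_cmult_right [OF beta [of "nat n"]] by (simp add: \<beta>'_def G_def)
    qed
  qed
  then have "((\<lambda>n. \<beta>' (int n)) has_sum S) UNIV"
    by (subst (asm) has_sum_int_iff_nat) (simp_all add: \<beta>'_def)
  moreover have "\<beta>' (int n) = q ^ (n\<^sup>2 + s * n) * \<beta> n" for n
    using power_int_of_nat [of q "n\<^sup>2 + s * n"] by (simp add: \<beta>'_def)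
  moreover have "S = \<theta> / qpoch_inf q q"
  proof (rule has_sum_unique)
    have "((\<lambda>(k, n). G (n, k)) has_sum S) (UNIV \<times> UNIV)"
      using S by (subst (asm) has_sum_swap)
    then show "((\<lambda>k. (-1) powi k * q powi (5 * k\<^sup>2 + (c + 2 * int s) * k) * (1 / qpoch_inf q q)) has_sum S) UNIV"
    proof (rule has_sum_SigmaD, unfold prod.case)
      fix k
      have "G (n + 2 * k, k) = (-1) powi k * q powi (5 * k\<^sup>2 + (c + 2 * int s) * k)
          * durfee_term (4 * k + int s) n" for n
      proof -
        have "(n + 2 * k)\<^sup>2 + int s * (n + 2 * k) + (k\<^sup>2 + c * k)
            = 5 * k\<^sup>2 + (c + 2 * int s) * k + (n\<^sup>2 + n * (4 * k + int s))"
          by (simp add: power2_eq_square algebra_simps)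
        then have "q powi ((n + 2 * k)\<^sup>2 + int s * (n + 2 * k)) * q powi (k\<^sup>2 + c * k)
            = q powi (5 * k\<^sup>2 + (c + 2 * int s) * k) * q powi (n\<^sup>2 + n * (4 * k + int s))"
          by (simp only: powi_add [symmetric])
        then have "q powi ((n + 2 * k)\<^sup>2 + int s * (n + 2 * k))
            * ((-1) powi k * q powi (k\<^sup>2 + c * k) * (rq n * rq (n + (4 * k + int s))))
          = (-1) powi k * q powi (5 * k\<^sup>2 + (c + 2 * int s) * k)
            * (q powi (n\<^sup>2 + n * (4 * k + int s)) * rq n * rq (n + (4 * k + int s)))"
          by (rule mult_regroup)
        moreover have "n + 2 * k - 2 * k = n" "n + 2 * k + int s + 2 * k = n + (4 * k + int s)"
          by simp_all
        ultimately show ?thesis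
          by (simp only: G_def bterm_def durfee_term_def prod.case)
      qed
      then have "((\<lambda>n. G (n + 2 * k, k)) has_sum
          (-1) powi k * q powi (5 * k\<^sup>2 + (c + 2 * int s) * k) * (1 / qpoch_inf q q)) UNIV"
        by (simp only: has_sum_cmult_right durfee_has_sum)
      then show "((\<lambda>n. G (n, k)) has_sum
          (-1) powi k * q powi (5 * k\<^sup>2 + (c + 2 * int s) * k) * (1 / qpoch_inf q q)) UNIV"
        by (subst (asm) has_sum_shift_int [of "\<lambda>n. G (n, k)"])
    qed
    show "((\<lambda>k. (-1) powi k * q powi (5 * k\<^sup>2 + (c + 2 * int s) * k) * (1 / qpoch_inf q q)) has_sum
        \<theta> / qpoch_inf q q) UNIV"
      using has_sum_cmult_left [OF theta, of "1 / qpoch_inf q q"] by simp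
  qed
  ultimately show ?thesis by simp
qed

end

section \<open>Reduction of the double sums\<close>

context q_base
begin

lemma qpoch_inf_powi_eq_0: "qpoch_inf (q powi (- int i)) q = 0"
proof -
  have "qpoch (q powi (- int i)) q (Suc i) = 0"
    using q_nonzero by (simp add: power_int_minus)
  then show ?thesis
    using qpoch_inf_split [OF q_norm, of "q powi (- int i)" "Suc i"] by (simp only: mult_zero_left)
qed

text \<open>Each factor 1 + q^(-j) with 1 <= j <= i equals q^(-j) (1 + q^j); the extracted powers
  multiply to q^(-i(i+1)/2).\<close>

lemma qpoch_powi_minus:
  "qpoch (- (q powi (- int i))) q i = q powi (- tri (int i + 1)) * qpoch (- q) q i"
proof (induction i)
  case (Suc i)
  define X where "X = q powi (- int (Suc i))"
  have X: "X * q ^ Suc i = 1"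
    using q_nonzero by (simp add: X_def power_int_minus field_simps del: of_nat_Suc)
  have Xq: "X * q = q powi (- int i)"
    using powi_add [of "- int (Suc i)" 1] by (simp add: X_def)
  have "tri (int (Suc i) + 1) = tri (int i + 1) + int (Suc i)"
  proof -
    have "2 * tri (int (Suc i) + 1) = 2 * (tri (int i + 1) + int (Suc i))"
      unfolding distrib_left two_times_tri by (simp add: algebra_simps)
    then show ?thesis by simp
  qed
  then have t: "q powi (- tri (int (Suc i) + 1)) = q powi (- tri (int i + 1)) * X"
    by (simp add: X_def powi_add [symmetric])
  have "qpoch (- X) q (Suc i) = (1 + X) * qpoch (- (X * q)) q i"
    using qpoch_add [of "- X" q 1 i] by simp
  also have "\<dots> = (1 + X) * (q powi (- tri (int i + 1)) * qpoch (- q) q i)"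
    by (simp only: Xq Suc.IH)
  also have "1 + X = X * (1 + q ^ Suc i)"
    using X by (simp only: distrib_left) simp
  finally have "qpoch (- X) q (Suc i)
      = X * (1 + q ^ Suc i) * (q powi (- tri (int i + 1)) * qpoch (- q) q i)" .
  moreover have "qpoch (- q) q (Suc i) = qpoch (- q) q i * (1 + q ^ Suc i)" by simp
  ultimately show ?case
    by (simp only: t X_def [symmetric] mult_ac)
qed (simp add: tri_def)

text \<open>Half of (-q^(-i);q)_inf: the factor with k = i is 1 + 1 = 2, which the parity split
  divides out.\<close>

definition half_value :: "nat \<Rightarrow> complex" where
  "half_value i = q powi (- tri (int i + 1)) * qpoch (- q) q i * qpoch_inf (- q) q"

lemma qpoch_inf_powi_minus: "qpoch_inf (- (q powi (- int i))) q = 2 * half_value i"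
proof -
  have "qpoch_inf (- (q powi (- int i))) q = qpoch (- (q powi (- int i))) q i * qpoch_inf (- 1) q"
    using qpoch_inf_split [OF q_norm, of "- (q powi (- int i))" i] q_nonzero
    by (simp add: power_int_minus)
  also have "qpoch_inf (- 1) q = 2 * qpoch_inf (- q) q"
    using qpoch_inf_split [OF q_norm, of "- 1" 1] by simp
  finally show ?thesis by (simp add: qpoch_powi_minus half_value_def)
qed

lemma euler_parity_has_sum:
  shows "((\<lambda>j. q powi (2 * int j ^ 2 - int j - 2 * int i * int j) / qpoch q q (2 * j))
      has_sum half_value i) UNIV" (is "(?even has_sum _) _")
    and "((\<lambda>j. q powi (2 * int j ^ 2 + int j - int i * (2 * int j + 1)) / qpoch q q (2 * j + 1))
      has_sum half_value i) UNIV" (is "(?odd has_sum _) _")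
proof -
  define z where "z = q powi (- int i)"
  define e where "e n = q ^ (n * (n - 1) div 2) * z ^ n / qpoch q q n" for n
  have plus: "(e has_sum 2 * half_value i) UNIV"
    using euler_has_sum [OF q_norm, of z]
    by (simp add: e_def [abs_def] z_def qpoch_inf_powi_minus)
  have "((\<lambda>n. (-1) ^ n * e n) has_sum 0) UNIV"
    using euler_has_sum [OF q_norm, of "- z"]
    by (simp add: e_def [abs_def] z_def qpoch_inf_powi_eq_0 power_minus [of "q powi _"] mult_ac)
  note sums = has_sum_add [OF plus this] has_sum_diff [OF plus this]
  have z_power: "z ^ n = q powi (- int i * int n)" for n
    by (simp add: z_def power_int_power')
  have e_powi: "e n = q powi (int (n * (n - 1) div 2) + - int i * int n) / qpoch q q n" for n
    by (simp only: e_def z_power powi_add power_int_of_nat)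
  have e_even: "e (2 * j) = ?even j" for j
  proof -
    have "int (2 * j * (2 * j - 1) div 2) + (- int i * int (2 * j)) = 2 * int j ^ 2 - int j - 2 * int i * int j"
      by (cases j) (simp_all add: power2_eq_square algebra_simps)
    then show ?thesis by (simp only: e_powi)
  qed
  have e_odd: "e (2 * j + 1) = ?odd j" for j
  proof -
    have "int ((2 * j + 1) * (2 * j + 1 - 1) div 2) + (- int i * int (2 * j + 1))
        = 2 * int j ^ 2 + int j - int i * (2 * int j + 1)"
      by (simp add: power2_eq_square algebra_simps)
    then show ?thesis by (simp only: e_powi)
  qed
  have "((\<lambda>n. e n + (-1) ^ n * e n) has_sum 2 * half_value i) (range (\<lambda>j. 2 * j))"
  proof (subst has_sum_cong_neutral [where T = UNIV])
    fix n :: nat assume "n \<in> UNIV - range (\<lambda>j. 2 * j)"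
    then have "odd n" by (auto elim: evenE)
    then show "e n + (-1) ^ n * e n = 0" by simp
  qed (use sums(1) in auto)
  then have "((\<lambda>j. 2 * ?even j) has_sum 2 * half_value i) UNIV"
    by (subst (asm) has_sum_reindex) (simp_all add: inj_def o_def e_even [symmetric])
  then show "(?even has_sum half_value i) UNIV"
    by (subst (asm) has_sum_cmult_right_iff) simp_all
  have "((\<lambda>n. e n - (-1) ^ n * e n) has_sum 2 * half_value i) (range (\<lambda>j. 2 * j + 1))"
  proof (subst has_sum_cong_neutral [where T = UNIV])
    fix n :: nat assume "n \<in> UNIV - range (\<lambda>j. 2 * j + 1)"
    then have "even n" by (metis DiffE oddE range_eqI)
    then show "e n - (-1) ^ n * e n = 0" by simp
  qed (use sums(2) in auto)
  then have "((\<lambda>j. 2 * ?odd j) has_sum 2 * half_value i) UNIV"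
    by (subst (asm) has_sum_reindex) (simp_all only: inj_def o_def e_odd [symmetric], simp_all)
  then show "(?odd has_sum half_value i) UNIV"
    by (subst (asm) has_sum_cmult_right_iff) simp_all
qed

text \<open>The negative powers disappear here, because 2n^2 - n(n+1)/2 = n^2 + n(n-1)/2. This links
  the Euler side to the Bailey pair.\<close>

lemma powi_half_value:
  "q powi (2 * int n ^ 2) * half_value n
    = qpoch_inf (- q) q * (q ^ n\<^sup>2 * (bpair n * qpoch q q (2 * n)))"
proof -
  have "2 * (2 * int n ^ 2 + - tri (int n + 1)) = 2 * (int (n\<^sup>2) + tri (int n))"
    unfolding distrib_left mult_minus_right two_times_tri by (simp add: power2_eq_square algebra_simps)
  then have "2 * int n ^ 2 + - tri (int n + 1) = int (n\<^sup>2) + tri (int n)"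
    by (subst (asm) mult_left_cancel) simp_all
  then have "q powi (2 * int n ^ 2) * q powi (- tri (int n + 1)) = q powi int (n\<^sup>2) * q powi tri (int n)"
    by (simp only: powi_add [symmetric])
  also have "\<dots> = q ^ n\<^sup>2 * q ^ (n * (n - 1) div 2)"
    by (simp only: tri_of_nat power_int_of_nat)
  finally have "q powi (2 * int n ^ 2) * q powi (- tri (int n + 1)) = q ^ n\<^sup>2 * q ^ (n * (n - 1) div 2)" .
  then show ?thesis
    using qpoch_nonzero [OF q_norm, of "2 * n"] by (simp add: half_value_def bpair_def)
qed

text \<open>The premise asks for at least 2i^2 - 2ij + 2j^2 - i - j, a lower bound common to all
  five exponents. Dropping the square (i - j)^2 leaves a majorant that is a product in i and
  j.\<close>

lemma double_series_summable:
  fixes e :: "nat \<Rightarrow> nat \<Rightarrow> int"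
  assumes "\<And>i j. e i j \<ge> (int i - int j)\<^sup>2 + (int i ^ 2 - int i) + (int j ^ 2 - int j)"
  shows "(\<lambda>(i, j). q powi e i j / (qpoch q q (a i) * qpoch q q (b j))) summable_on UNIV"
proof -
  obtain C where C: "C > 0" "\<And>n. norm (1 / qpoch q q n) \<le> C"
    using norm_inverse_qpoch_bounded [OF q_norm] by blast
  have "(\<lambda>k. norm q powi (k\<^sup>2 + (-1) * k)) summable_on range int"
    using summable_on_powi_quadratic [OF norm_q_pos q_norm] by (rule summable_on_subset) simp
  then have s: "(\<lambda>n. norm q powi (int n ^ 2 - int n)) summable_on UNIV"
    by (subst (asm) summable_on_reindex) (simp_all add: inj_def o_def)
  have "(\<lambda>x. norm (case x of (i, j) \<Rightarrow> q powi e i j / (qpoch q q (a i) * qpoch q q (b j))))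
      summable_on UNIV \<times> UNIV"
  proof (rule Infinite_Sum.abs_summable_on_comparison_test')
    show "(\<lambda>x. (case x of (i, j) \<Rightarrow> norm q powi (int i ^ 2 - int i) * norm q powi (int j ^ 2 - int j)) * (C * C))
        summable_on UNIV \<times> UNIV"
      by (intro summable_on_cmult_left summable_on_product_mult s) auto
    fix x :: "nat \<times> nat"
    obtain i j where x: "x = (i, j)" by fastforce
    have "norm (q powi e i j / (qpoch q q (a i) * qpoch q q (b j)))
        = norm q powi e i j * (norm (1 / qpoch q q (a i)) * norm (1 / qpoch q q (b j)))"
      by (simp add: norm_mult norm_divide norm_power_int)
    also have "\<dots> \<le> norm q powi ((int i ^ 2 - int i) + (int j ^ 2 - int j)) * (C * C)"
    proof (intro mult_mono C power_int_decreasing)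
      show "(int i ^ 2 - int i) + (int j ^ 2 - int j) \<le> e i j"
        using assms [of i j] zero_le_power2 [of "int i - int j"] by linarith
    qed (use C q_norm q_nonzero in auto)
    finally show "norm (case x of (i, j) \<Rightarrow> q powi e i j / (qpoch q q (a i) * qpoch q q (b j)))
        \<le> (case x of (i, j) \<Rightarrow> norm q powi (int i ^ 2 - int i) * norm q powi (int j ^ 2 - int j)) * (C * C)"
      using q_nonzero by (simp add: x power_int_add)
  qed
  then show ?thesis unfolding UNIV_Times_UNIV by (rule abs_summable_summable)
qed

text \<open>Euler's identity turns (-q;q)_inf into 1/(q;q^2)_inf. Splitting (q;q)_inf by parity and
  its even part modulo 10 lets the theta factors cancel three of the five products with base
  q^10.\<close>

lemma product_side:
  shows "qpoch_inf (- q) q * (qpoch_inf (q ^ 10) (q ^ 10) * qpoch_inf (q ^ 6) (q ^ 10)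
        * qpoch_inf (q ^ 4) (q ^ 10) / qpoch_inf q q)
      = 1 / (qpoch_inf q (q ^ 2) ^ 2 * qpochs_inf [q ^ 2, q ^ 8] (q ^ 10))" (is ?thesis1)
    and "qpoch_inf (- q) q * (qpoch_inf (q ^ 10) (q ^ 10) * qpoch_inf (q ^ 8) (q ^ 10)
        * qpoch_inf (q ^ 2) (q ^ 10) / qpoch_inf q q)
      = 1 / (qpoch_inf q (q ^ 2) ^ 2 * qpochs_inf [q ^ 4, q ^ 6] (q ^ 10))" (is ?thesis2)
proof -
  have "norm (q ^ n) < 1" if "n > 0" for n
    using q_norm that by (simp add: norm_power power_less_one_iff)
  then have nz: "qpoch_inf (q ^ m) (q ^ n) \<noteq> 0" if "m > 0" "n > 0" for m n
    using that by (simp add: qpoch_inf_nonzero)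
  have q: "qpoch_inf q q = qpoch_inf q (q ^ 2) * qpoch_inf (q ^ 2) (q ^ 2)"
    using qpoch_inf_dissect [OF q_norm, of 2 q] by (simp add: numeral_2_eq_2)
  have "norm (q ^ 2) < 1"
    using q_norm by (simp add: norm_power power_less_one_iff)
  from qpoch_inf_dissect [OF this, of 5 "q ^ 2"]
  have q2: "qpoch_inf (q ^ 2) (q ^ 2) = qpoch_inf (q ^ 2) (q ^ 10) * qpoch_inf (q ^ 4) (q ^ 10)
      * qpoch_inf (q ^ 6) (q ^ 10) * qpoch_inf (q ^ 8) (q ^ 10) * qpoch_inf (q ^ 10) (q ^ 10)"
    by (simp add: eval_nat_numeral mult.assoc)
  have "qpoch_inf q q * qpoch_inf (- q) q = qpoch_inf (q ^ 2) (q ^ 2)"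
    by (rule qpoch_inf_mult_uminus [OF q_norm])
  then have "qpoch_inf q (q ^ 2) * qpoch_inf (- q) q = 1"
    using nz [of 2 2] by (simp add: q)
  then have m: "qpoch_inf (- q) q = 1 / qpoch_inf q (q ^ 2)"
    by (metis mult_zero_left nonzero_mult_div_cancel_left zero_neq_one)
  show ?thesis1 ?thesis2
    using nz [of 1 2] nz [of 2 10] nz [of 4 10] nz [of 6 10] nz [of 8 10] nz [of 10 10]
    by (simp_all add: m q q2 qpochs_inf_def divide_simps power2_eq_square [of "qpoch_inf _ _"])
qed

section \<open>The three Rogers sums and the outer summations\<close>

lemma has_sum_bpair:
  "((\<lambda>n. q ^ n\<^sup>2 * bpair n) has_sum
    qpoch_inf (q ^ 10) (q ^ 10) * qpoch_inf (q ^ 6) (q ^ 10) * qpoch_inf (q ^ 4) (q ^ 10)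
      / qpoch_inf q q) UNIV"
proof -
  \<comment> \<open>Reflection at s = 0 replaces c = -1 by c = 1, so that the linear theta
    coefficient is a natural number.\<close>
  have "(bterm (int 0) 1 (int n) has_sum bpair n) UNIV" for n
    using bterm_zero_has_sum [of n] by (subst (asm) bterm_has_sum_reflect) simp
  from bailey_has_sum [OF this] show ?thesis
    using theta_has_sum [of 1] by simp
qed

text \<open>Here c + 2s = -1 + 2 = 1, so the theta series is that of \<open>has_sum_bpair\<close>
  and the products agree.\<close>

lemma has_sum_bpair_odd:
  "((\<lambda>n. q ^ (n\<^sup>2 + n) * (bpair n / (1 - q ^ (2 * n + 1)))) has_sum
    qpoch_inf (q ^ 10) (q ^ 10) * qpoch_inf (q ^ 6) (q ^ 10) * qpoch_inf (q ^ 4) (q ^ 10)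
      / qpoch_inf q q) UNIV"
  using bailey_has_sum [of 1 "-1", unfolded of_nat_1, OF bterm_one_has_sum(1) [OF bterm_zero_has_sum]]
    theta_has_sum [of 1] by simp

lemma has_sum_bpair_odd':
  "((\<lambda>n. q ^ (n\<^sup>2 + n) * (q ^ n * bpair n / (1 - q ^ (2 * n + 1)))) has_sum
    qpoch_inf (q ^ 10) (q ^ 10) * qpoch_inf (q ^ 8) (q ^ 10) * qpoch_inf (q ^ 2) (q ^ 10)
      / qpoch_inf q q) UNIV"
  using bailey_has_sum [of 1 1, unfolded of_nat_1, OF bterm_one_has_sum(2) [OF bterm_zero_has_sum]]
    theta_has_sum [of 3] by simp

lemma double_series_has_sum:
  fixes e :: "nat \<Rightarrow> nat \<Rightarrow> int"
  assumes "\<And>i j. e i j \<ge> (int i - int j)\<^sup>2 + (int i ^ 2 - int i) + (int j ^ 2 - int j)"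
    and "\<And>i j. e i j = d i + h i j"
    and "\<And>i. ((\<lambda>j. q powi h i j / qpoch q q (b j)) has_sum half_value i) UNIV"
    and "((\<lambda>i. q powi d i / qpoch q q (a i) * half_value i) has_sum S) UNIV"
  shows "((\<lambda>(i, j). q powi e i j / (qpoch q q (a i) * qpoch q q (b j))) has_sum S) UNIV"
  unfolding UNIV_Times_UNIV [symmetric]
proof (rule has_sum_SigmaI [OF _ assms(4)])
  show "((\<lambda>j. case (i, j) of (i, j) \<Rightarrow> q powi e i j / (qpoch q q (a i) * qpoch q q (b j))) has_sum
      q powi d i / qpoch q q (a i) * half_value i) UNIV" for i
    using has_sum_cmult_right [OF assms(3) [of i], of "q powi d i / qpoch q q (a i)"]
    by (simp add: assms(2) powi_add)
  show "(\<lambda>(i, j). q powi e i j / (qpoch q q (a i) * qpoch q q (b j))) summable_on UNIV \<times> UNIV"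
    using double_series_summable [OF assms(1)] by simp
qed

lemma double_series_has_sum_swap:
  fixes e :: "nat \<Rightarrow> nat \<Rightarrow> int"
  assumes "\<And>i j. e i j \<ge> (int i - int j)\<^sup>2 + (int i ^ 2 - int i) + (int j ^ 2 - int j)"
    and "\<And>i j. e i j = d j + h j i"
    and "\<And>j. ((\<lambda>i. q powi h j i / qpoch q q (a i)) has_sum half_value j) UNIV"
    and "((\<lambda>j. q powi d j / qpoch q q (b j) * half_value j) has_sum S) UNIV"
  shows "((\<lambda>(i, j). q powi e i j / (qpoch q q (a i) * qpoch q q (b j))) has_sum S) UNIV"
proof -
  have "e i j \<ge> (int j - int i)\<^sup>2 + (int j ^ 2 - int j) + (int i ^ 2 - int i)" for i j
    using assms(1) [of i j] power2_commute [of "int i" "int j"] by linarith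
  then have "((\<lambda>(j, i). q powi e i j / (qpoch q q (b j) * qpoch q q (a i))) has_sum S) UNIV"
    by (rule double_series_has_sum [OF _ assms(2,3,4)])
  then show ?thesis
    unfolding UNIV_Times_UNIV [symmetric]
    by (subst (asm) has_sum_swap) (simp add: mult.commute)
qed

lemma outer_even:
  "((\<lambda>n. q powi (2 * int n ^ 2) / qpoch q q (2 * n) * half_value n) has_sum
    1 / (qpoch_inf q (q ^ 2) ^ 2 * qpochs_inf [q ^ 2, q ^ 8] (q ^ 10))) UNIV"
proof -
  have "q powi (2 * int n ^ 2) / qpoch q q (2 * n) * half_value n
      = qpoch_inf (- q) q * (q ^ n\<^sup>2 * bpair n)" for n
    using powi_half_value [of n] qpoch_nonzero [OF q_norm, of "2 * n"] by (simp add: field_simps)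
  then show ?thesis
    using has_sum_cmult_right [OF has_sum_bpair, of "qpoch_inf (- q) q"]
    by (simp only: product_side)
qed

text \<open>The free exponent k is n in \<open>outer_odd\<close> and 2n in
  \<open>outer_odd'\<close>.\<close>

lemma outer_odd_summand:
  "q powi (2 * int n ^ 2 + int k) / qpoch q q (2 * n + 1) * half_value n
    = qpoch_inf (- q) q * (q ^ (n\<^sup>2 + k) * (bpair n / (1 - q ^ (2 * n + 1))))"
proof -
  have "q powi (2 * int n ^ 2 + int k) / qpoch q q (2 * n + 1) * half_value n
      = q ^ k * (q powi (2 * int n ^ 2) * half_value n) / qpoch q q (2 * n + 1)"
    by (simp add: powi_add)
  also have "\<dots> = qpoch_inf (- q) q * (q ^ (n\<^sup>2 + k) * (bpair n / (1 - q ^ (2 * n + 1))))"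
    unfolding powi_half_value
    using qpoch_nonzero [OF q_norm, of "2 * n"] by (simp add: power_add)
  finally show ?thesis .
qed

lemma outer_odd:
  "((\<lambda>n. q powi (2 * int n ^ 2 + int n) / qpoch q q (2 * n + 1) * half_value n) has_sum
    1 / (qpoch_inf q (q ^ 2) ^ 2 * qpochs_inf [q ^ 2, q ^ 8] (q ^ 10))) UNIV"
  using has_sum_cmult_right [OF has_sum_bpair_odd, of "qpoch_inf (- q) q"]
  by (simp only: outer_odd_summand product_side)

lemma outer_odd':
  "((\<lambda>n. q powi (2 * int n ^ 2 + int (2 * n)) / qpoch q q (2 * n + 1) * half_value n) has_sum
    1 / (qpoch_inf q (q ^ 2) ^ 2 * qpochs_inf [q ^ 4, q ^ 6] (q ^ 10))) UNIV"
proof -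
  have "q ^ (n\<^sup>2 + 2 * n) * (bpair n / (1 - q ^ (2 * n + 1)))
      = q ^ (n\<^sup>2 + n) * (q ^ n * bpair n / (1 - q ^ (2 * n + 1)))" for n
    by (simp add: power_add mult_2)
  then show ?thesis
    using has_sum_cmult_right [OF has_sum_bpair_odd', of "qpoch_inf (- q) q"]
    by (simp only: outer_odd_summand product_side)
qed

end

text \<open>Only pairs with exponent 0 contribute, since \<open>0 powi 0\<close> is 1. The lower
  bound forces i = j with i at most 1, and the premise on \<open>e 1 1\<close> leaves just the
  origin.\<close>

lemma has_sum_at_zero:
  fixes e :: "nat \<Rightarrow> nat \<Rightarrow> int"
  assumes ge: "\<And>i j. e i j \<ge> (int i - int j)\<^sup>2 + (int i ^ 2 - int i) + (int j ^ 2 - int j)"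
    and "e 0 0 = 0" "e 1 1 \<noteq> 0"
  shows "((\<lambda>(i, j). (0 :: complex) powi e i j / (qpoch 0 0 (a i) * qpoch 0 0 (b j))) has_sum 1) UNIV"
proof (rule has_sum_finite_neutralI [of "{(0, 0)}"])
  have pos: "int i ^ 2 - int i \<ge> 0" for i
    by (cases i) (simp_all add: power2_eq_square algebra_simps)
  have "e i j \<noteq> 0" if "(i, j) \<noteq> (0, 0)" for i j
  proof
    assume "e i j = 0"
    then have "(int i - int j)\<^sup>2 = 0" "int i ^ 2 - int i = 0"
      using ge [of i j] pos [of i] pos [of j] zero_le_power2 [of "int i - int j"] by linarith+
    then have "i = j" "i = 0 \<or> i = 1"
      by (auto simp: power2_eq_square)
    with that \<open>e i j = 0\<close> assms(3) show False by auto
  qed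
  then show "(case x of (i, j) \<Rightarrow> (0 :: complex) powi e i j / (qpoch 0 0 (a i) * qpoch 0 0 (b j))) = 0"
    if "x \<in> UNIV - {(0, 0)}" for x
    using that by (cases x) auto
qed (use assms(2) in \<open>auto simp: qpoch_def\<close>)

theorem theorem5p5:
  fixes q :: complex
  assumes "norm q < 1"
  shows
    "((\<lambda>(i::nat, j::nat).
         q powi (2 * int i ^ 2 - 2 * int i * int j + 2 * int j ^ 2 - int j)
           / (qpoch q q (2 * i) * qpoch q q (2 * j)))
       has_sum (1 / (qpoch_inf q (q ^ 2) ^ 2 * qpochs_inf [q ^ 2, q ^ 8] (q ^ 10)))) UNIV
   \<and> ((\<lambda>(i::nat, j::nat).
         q powi (2 * int i ^ 2 - 2 * int i * int j + 2 * int j ^ 2 - int i + int j)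
           / (qpoch q q (2 * i) * qpoch q q (2 * j + 1)))
       has_sum (1 / (qpoch_inf q (q ^ 2) ^ 2 * qpochs_inf [q ^ 2, q ^ 8] (q ^ 10)))) UNIV
   \<and> ((\<lambda>(i::nat, j::nat).
         q powi (2 * int i ^ 2 - 2 * int i * int j + 2 * int j ^ 2 + int i)
           / (qpoch q q (2 * i + 1) * qpoch q q (2 * j + 1)))
       has_sum (1 / (qpoch_inf q (q ^ 2) ^ 2 * qpochs_inf [q ^ 2, q ^ 8] (q ^ 10)))) UNIV
   \<and> ((\<lambda>(i::nat, j::nat).
         q powi (2 * int i ^ 2 - 2 * int i * int j + 2 * int j ^ 2 + 2 * int i - int j)
           / (qpoch q q (2 * i + 1) * qpoch q q (2 * j)))
       has_sum (1 / (qpoch_inf q (q ^ 2) ^ 2 * qpochs_inf [q ^ 4, q ^ 6] (q ^ 10)))) UNIV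
   \<and> ((\<lambda>(i::nat, j::nat).
         q powi (2 * int i ^ 2 - 2 * int i * int j + 2 * int j ^ 2 + int i + int j)
           / (qpoch q q (2 * i + 1) * qpoch q q (2 * j + 1)))
       has_sum (1 / (qpoch_inf q (q ^ 2) ^ 2 * qpochs_inf [q ^ 4, q ^ 6] (q ^ 10)))) UNIV"
proof -
  have square: "(int i - int j)\<^sup>2 + (int i ^ 2 - int i) + (int j ^ 2 - int j)
      = 2 * int i ^ 2 - 2 * int i * int j + 2 * int j ^ 2 - int i - int j" for i j
    by (simp add: power2_eq_square algebra_simps)
  show ?thesis
  proof (cases "q = 0")
    case True
    have "qpoch_inf 0 p = 1" for p
      by (simp add: qpoch_inf_def)
    then show ?thesis
      unfolding True
      by (intro conjI) (simp_all add: qpochs_inf_def has_sum_at_zero square)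
  next
    case False
    then interpret q_base q
      using assms by unfold_locales
    show ?thesis
      by (intro conjI
          double_series_has_sum [OF _ _ euler_parity_has_sum(1) outer_even]
          double_series_has_sum [OF _ _ euler_parity_has_sum(2) outer_even]
          double_series_has_sum_swap [OF _ _ euler_parity_has_sum(2) outer_odd]
          double_series_has_sum [OF _ _ euler_parity_has_sum(1) outer_odd']
          double_series_has_sum_swap [OF _ _ euler_parity_has_sum(2) outer_odd'])
        \<comment> \<open>What remains for each sum is the lower bound on its exponent and the
          splitting into outer and inner parts.\<close>
        (simp_all add: square, simp_all add: power2_eq_square algebra_simps)
  qed
qed

end
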